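(* Let $\Omega\subset\mathbb{R}^D$ be compact (with $|\Omega|>0$) and let $\omega:\Omega\to[0,\infty)$ be a Riemann integrable weight function that is positive almost everywhere. Further, let $d\ge 0$ be an integer, let $\varphi:[0,\infty)\to\mathbb{R}$ be a continuous and conditionally positive definite kernel of order $d$, let $\{\mathbf{y}_m\}_{m=1}^M\subset\Omega$ be a given set of centers, and let $\mathcal{S}_{M,d}$ be the associated $M$-dimensional RBF space. If $(\mathbf{x}_n)_{n\in\mathbb{N}}$ is an equidistributed sequence in $\Omega$ with $\omega(\mathbf{x}_n)>0$ for all $n\in\mathbb{N}$, then there exists an $N_0\in\mathbb{N}$ such that for all $N\ge N_0$ and discrete weights $$r_{n,N}=\frac{|\Omega|\,\omega(\mathbf{x}_n)}{N},\quad n=1,\dots,N,$$ the corresponding least-squares RBF quadrature formula $$C_N^{\rm LS}[f]=\sum_{n=1}^N w_n^{\rm LS}f(\mathbf{x}_n),\qquad \mathbf{w}^{\rm LS}=\operatorname*{arg\,min}_{\mathbf{w}\in W}\|R^{-1/2}\mathbf{w}\|_2,$$ where $R^{-1/2}=\operatorname{diag}(1/\sqrt{r_{1,N}},\dots,1/\sqrt{r_{N,N}})$, is positive (i.e. $w_n^{\rm LS}>0$ for $n=1,\dots,N$) and exact for all $f\in\mathcal{S}_{M,d}$ (i.e. $C_N^{\rm LS}[f]=I[f]$ for all $f\in\mathcal{S}_{M,d}$). Here $W=W_N$ is the affine space of all $\mathbf{w}\in\mathbb{R}^N$ with $\sum_{n=1}^N w_nf(\mathbf{x}_n)=I[f]$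 for all $f\in\mathcal{S}_{M,d}$.
   Context: $I[f]=\int_\Omega f(\boldsymbol{x})\,\omega(\boldsymbol{x})\,\mathrm{d}\boldsymbol{x}$, and $|\Omega|$ is the volume of the domain $\Omega$. A sequence $(\mathbf{x}_n)_{n\in\mathbb{N}}\subset\Omega$ is equidistributed in $\Omega$ if $\lim_{N\to\infty}\frac{|\Omega|}{N}\sum_{n=1}^N g(\mathbf{x}_n)=\int_\Omega g(\boldsymbol{x})\,\mathrm{d}\boldsymbol{x}$ for all measurable bounded functions $g:\Omega\to\mathbb{R}$ that are continuous almost everywhere (Lebesgue). Let $\{p_k\}_{k=1}^K$ be a basis of the space $\mathbb{P}_d(\Omega)$ of algebraic polynomials of degree at most $d$ on $\Omega$. For distinct centers $\mathbf{y}_1,\dots,\mathbf{y}_M$ and fixed shape parameters $\varepsilon_1,\dots,\varepsilon_M\ge 0$, the RBF space $\mathcal{S}_{M,d}$ is the set of all functions on $\Omega$ of the form $$s(\boldsymbol{x})=\sum_{m=1}^M\alpha_m\varphi(\varepsilon_m\|\boldsymbol{x}-\mathbf{y}_m\|_2)+\sum_{k=1}^K\beta_kp_k(\boldsymbol{x}),\qquad \sum_{m=1}^M\alpha_mp_k(\mathbf{y}_m)=0,\ k=1,\dots,K.$$ Standing assumption: interpolation at the centers from this space is uniquely solvable (for every $(f_m)\in\mathbb{R}^M$ there are unique coefficients $\alpha=(\alpha_1,\dots,\alpha_M)\in\mathbb{R}^M$ and $\beta=(\beta_1,\dots,\beta_K)\in\mathbb{R}^K$ with $\sum_{m=1}^M\alpha_mp_k(\mathbf{y}_m)=0$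 for $k=1,\dots,K$ such that the function $s(\boldsymbol{x})=\sum_{m=1}^M\alpha_m\varphi(\varepsilon_m\|\boldsymbol{x}-\mathbf{y}_m\|_2)+\sum_{k=1}^K\beta_kp_k(\boldsymbol{x})$ satisfies $s(\mathbf{y}_m)=f_m$ for all $m$), so $\dim\mathcal{S}_{M,d}=M$. This is the case, for instance, for a constant shape parameter $\varepsilon_1=\dots=\varepsilon_M>0$ if $\varphi$ is conditionally positive definite of order $d$ and the centers are $\mathbb{P}_d(\Omega)$-unisolvent (only the zero polynomial of degree at most $d$ vanishes at all of them). With a basis $\{b_m\}_{m=1}^M$ of $\mathcal{S}_{M,d}$, the space $W$ is the solution set of the linear system $\sum_{n=1}^N b_m(\mathbf{x}_n)w_n=I[b_m]$, $m=1,\dots,M$.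
   Formalization: Ω is additionally assumed to be the closure of its interior; for merely compact Ω the claim can fail, e.g. Ω=[0,1]∪{2,3}, ω=1, φ(r)=max(0,1−r), d=0, centers 2 and 3, and x_1=2, where exactness forces w_1=0. *)

theory Defs
  imports "HOL-Analysis.Analysis"
begin

text \<open>
  Throughout, a function on \<open>\<Omega>\<close> is represented by a HOL function on the whole type whose
  values outside \<open>\<Omega>\<close> are irrelevant. Finite and infinite families are indexed from 0, and
  a vector in \<open>\<real>\<^sup>N\<close> is a function in \<open>{..<N} \<rightarrow>\<^sub>E UNIV\<close>.
\<close>

text \<open>
  The classical definition by Riemann sums, for the extension of \<open>f\<close> by 0 to a box around
  \<open>\<Omega>\<close>: it is the library's gauge integral with all gauges restricted to constant ones.
\<close>

definition riemann_integrable_on ::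
  "('a::euclidean_space \<Rightarrow> real) \<Rightarrow> 'a set \<Rightarrow> bool" (infixr \<open>riemann'_integrable'_on\<close> 46)
  where "f riemann_integrable_on \<Omega> \<longleftrightarrow>
    (\<exists>a b J. \<Omega> \<subseteq> box a b \<and>
      (\<forall>e>0. \<exists>\<delta>>0. \<forall>\<D>. \<D> tagged_division_of (cbox a b) \<and> (\<lambda>x. ball x \<delta>) fine \<D> \<longrightarrow>
        \<bar>(\<Sum>(x, k)\<in>\<D>. Henstock_Kurzweil_Integration.content k * (if x \<in> \<Omega> then f x else 0)) - J\<bar> < e))"

definition equidistributed_in ::
  "(nat \<Rightarrow> 'a::euclidean_space) \<Rightarrow> 'a set \<Rightarrow> bool" (infix \<open>equidistributed'_in\<close> 50)
  where "x equidistributed_in \<Omega> \<longleftrightarrow>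
    (\<forall>n. x n \<in> \<Omega>) \<and>
    (\<forall>g :: 'a \<Rightarrow> real.
      g \<in> borel_measurable (lebesgue_on \<Omega>) \<and> bounded (g ` \<Omega>) \<and>
      (AE z in lebesgue_on \<Omega>. continuous (at z within \<Omega>) g) \<longrightarrow>
      (\<lambda>N. measure lebesgue \<Omega> / real N * (\<Sum>n<N. g (x n))) \<longlonglongrightarrow> (LINT z:\<Omega>|lebesgue. g z))"

definition weighted_integral ::
  "'a::euclidean_space set \<Rightarrow> ('a \<Rightarrow> real) \<Rightarrow> ('a \<Rightarrow> real) \<Rightarrow> real"
  where "weighted_integral \<Omega> \<omega> f = (LINT z:\<Omega>|lebesgue. f z * \<omega> z)"

definition polys_on :: "(real ^ 'n) set \<Rightarrow> nat \<Rightarrow> (real ^ 'n \<Rightarrow> real) set"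
  where "polys_on \<Omega> d =
    {f. \<exists>c :: ('n \<Rightarrow> nat) \<Rightarrow> real. \<forall>x\<in>\<Omega>.
      f x = (\<Sum>a | (\<Sum>i\<in>UNIV. a i) \<le> d. c a * (\<Prod>i\<in>UNIV. (x $ i) ^ a i))}"

definition basis_on ::
  "'a set \<Rightarrow> nat \<Rightarrow> (nat \<Rightarrow> 'a \<Rightarrow> real) \<Rightarrow> ('a \<Rightarrow> real) set \<Rightarrow> bool"
  where "basis_on \<Omega> K p F \<longleftrightarrow>
    (\<forall>k<K. p k \<in> F) \<and>
    (\<forall>f\<in>F. \<exists>c. \<forall>x\<in>\<Omega>. f x = (\<Sum>k<K. c k * p k x)) \<and>
    (\<forall>c. (\<forall>x\<in>\<Omega>. (\<Sum>k<K. c k * p k x) = 0) \<longrightarrow> (\<forall>k<K. c k = 0))"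

text \<open>
  The moment conditions range over all polynomials of degree at most \<open>d\<close>, matching those
  imposed on the RBF space. (In the convention where order \<open>d\<close> refers to degree less than
  \<open>d\<close>, a kernel of order \<open>d\<close> satisfies the condition below as well.)
\<close>

definition conditionally_pos_def_on :: "(real ^ 'n) set \<Rightarrow> nat \<Rightarrow> (real \<Rightarrow> real) \<Rightarrow> bool"
  where "conditionally_pos_def_on S d \<phi> \<longleftrightarrow>
    (\<forall>X \<alpha>. finite X \<and> X \<subseteq> S \<and> (\<exists>z\<in>X. \<alpha> z \<noteq> 0) \<and>
      (\<forall>q\<in>polys_on S d. (\<Sum>z\<in>X. \<alpha> z * q z) = 0) \<longrightarrow>
      (\<Sum>z\<in>X. \<Sum>z'\<in>X. \<alpha> z * \<alpha> z' * \<phi> (norm (z - z'))) > 0)"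

definition moment_conditions ::
  "nat \<Rightarrow> (nat \<Rightarrow> 'a) \<Rightarrow> nat \<Rightarrow> (nat \<Rightarrow> 'a \<Rightarrow> real) \<Rightarrow> (nat \<Rightarrow> real) \<Rightarrow> bool"
  where "moment_conditions M y K p \<alpha> \<longleftrightarrow> (\<forall>k<K. (\<Sum>m<M. \<alpha> m * p k (y m)) = 0)"

definition rbf_fun ::
  "(real \<Rightarrow> real) \<Rightarrow> nat \<Rightarrow> (nat \<Rightarrow> real) \<Rightarrow> (nat \<Rightarrow> 'a::real_normed_vector) \<Rightarrow>
   nat \<Rightarrow> (nat \<Rightarrow> 'a \<Rightarrow> real) \<Rightarrow> (nat \<Rightarrow> real) \<Rightarrow> (nat \<Rightarrow> real) \<Rightarrow> 'a \<Rightarrow> real"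
  where "rbf_fun \<phi> M \<epsilon> y K p \<alpha> \<beta> x =
    (\<Sum>m<M. \<alpha> m * \<phi> (\<epsilon> m * norm (x - y m))) + (\<Sum>k<K. \<beta> k * p k x)"

definition rbf_space ::
  "'a::real_normed_vector set \<Rightarrow> (real \<Rightarrow> real) \<Rightarrow> nat \<Rightarrow> (nat \<Rightarrow> real) \<Rightarrow> (nat \<Rightarrow> 'a) \<Rightarrow>
   nat \<Rightarrow> (nat \<Rightarrow> 'a \<Rightarrow> real) \<Rightarrow> ('a \<Rightarrow> real) set"
  where "rbf_space \<Omega> \<phi> M \<epsilon> y K p =
    {s. \<exists>\<alpha> \<beta>. moment_conditions M y K p \<alpha> \<and> (\<forall>x\<in>\<Omega>. s x = rbf_fun \<phi> M \<epsilon> y K p \<alpha> \<beta> x)}"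

definition uniquely_solvable ::
  "(real \<Rightarrow> real) \<Rightarrow> nat \<Rightarrow> (nat \<Rightarrow> real) \<Rightarrow> (nat \<Rightarrow> 'a::real_normed_vector) \<Rightarrow>
   nat \<Rightarrow> (nat \<Rightarrow> 'a \<Rightarrow> real) \<Rightarrow> bool"
  where "uniquely_solvable \<phi> M \<epsilon> y K p \<longleftrightarrow>
    (\<forall>f :: nat \<Rightarrow> real. \<exists>!ab. ab \<in> ({..<M} \<rightarrow>\<^sub>E UNIV) \<times> ({..<K} \<rightarrow>\<^sub>E UNIV) \<and>
      moment_conditions M y K p (fst ab) \<and>
      (\<forall>m<M. rbf_fun \<phi> M \<epsilon> y K p (fst ab) (snd ab) (y m) = f m))"

definition exact_weights ::
  "('a \<Rightarrow> real) set \<Rightarrow> (('a \<Rightarrow> real) \<Rightarrow> real) \<Rightarrow> (nat \<Rightarrow> 'a) \<Rightarrow> nat \<Rightarrow> (nat \<Rightarrow> real) set"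
  where "exact_weights F I x N =
    {w \<in> {..<N} \<rightarrow>\<^sub>E UNIV. \<forall>f\<in>F. (\<Sum>n<N. w n * f (x n)) = I f}"

text \<open>\<open>w\<close> minimises the Euclidean norm of \<open>R\<^bsup>-1/2\<^esup>w\<close> over \<open>W\<close>, where \<open>R = diag(r 0, \<dots>, r (N - 1))\<close>.\<close>

definition is_least_squares_weights ::
  "(nat \<Rightarrow> real) set \<Rightarrow> (nat \<Rightarrow> real) \<Rightarrow> nat \<Rightarrow> (nat \<Rightarrow> real) \<Rightarrow> bool"
  where "is_least_squares_weights W r N =
    is_arg_min (\<lambda>w. L2_set (\<lambda>n. 1 / sqrt (r n) * w n) {..<N}) (\<lambda>w. w \<in> W)"

end

theory Submission
  imports Defs
begin

text \<open>
  Let \<open>S\<close> carry the inner product \<open>I[fg]\<close> and its discretisation \<open>[f, g]\<^sub>N = \<Sum>\<^sub>n r\<^sub>n f(x\<^sub>n) g(x\<^sub>n)\<close>. If some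
  \<open>u\<^sub>N\<close> in \<open>S\<close> represents the integral, that is \<open>[u\<^sub>N, f]\<^sub>N = I[f]\<close> for all \<open>f\<close> in \<open>S\<close>, then the weights
  \<open>w\<^sub>n = r\<^sub>n u\<^sub>N(x\<^sub>n)\<close> are exact, and they are the unique least-squares weights, because
  \<open>R\<^bsup>-1\<^esup>w\<close> is the vector of values of a function in \<open>S\<close> and hence orthogonal to all
  differences of exact weights (\<open>least_squares_weights_iff\<close>). So it suffices that
  \<open>u\<^sub>N\<close> exists and is positive on \<open>\<Omega>\<close> for all large \<open>N\<close>.

  Now \<open>S\<close> contains the constants, and the constant \<open>1\<close> represents \<open>I\<close> for the continuous inner product.
  For a basis of \<open>S\<close>, equidistribution makes the discrete Gram matrices converge to the continuous
  one (\<open>equidistributed_weighted_sums\<close>), which is positive definite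
  (\<open>weighted_integral_square_pos\<close>). Hence the discrete systems are eventually solvable and
  their solutions converge to the coefficients of \<open>1\<close> (\<open>positive_definite_solution_tendsto\<close>). The
  basis functions are bounded, so \<open>u\<^sub>N\<close> tends to \<open>1\<close> uniformly and is positive from some \<open>N\<close> on. That
  \<open>S\<close> has a finite basis of continuous functions follows from unique solvability of the
  interpolation problem (\<open>rbf_space_cardinal_basis\<close>).

  Equidistribution may be applied only to bounded functions that are continuous almost everywhere,
  here to products of basis functions with the weight. A weight that is integrable in the sense of
  Riemann sums has these properties by Lebesgue's criterion
  (\<open>riemann_integrable_on_properties\<close>).
\<close>

section \<open>Lebesgue's criterion for Riemann integrability\<close>

definition riemann_sums_tendsto ::
  "('a::euclidean_space \<Rightarrow> real) \<Rightarrow> 'a \<Rightarrow> 'a \<Rightarrow> real \<Rightarrow> bool"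
  where "riemann_sums_tendsto g a b J \<longleftrightarrow>
    (\<forall>e>0. \<exists>\<delta>>0. \<forall>\<D>. \<D> tagged_division_of (cbox a b) \<and> (\<lambda>x. ball x \<delta>) fine \<D> \<longrightarrow>
      \<bar>(\<Sum>(x, k)\<in>\<D>. measure lborel k * g x) - J\<bar> < e)"

text \<open>
  In a division so fine that every cell lies in the ball of radius \<open>\<delta>\<close> around each of its own
  points, the tags can be moved freely within the cells, so two choices of tags give Riemann
  sums that are both close to \<open>J\<close>. This is Darboux's criterion, phrased with tags
  instead of suprema because \<open>g\<close> is not yet known to be bounded.
\<close>

lemma riemann_sums_small_oscillation:
  fixes g :: "'a::euclidean_space \<Rightarrow> real"
  assumes riemann: "riemann_sums_tendsto g a b J"
    and "e > 0"
  obtains \<K> where "\<K> division_of cbox a b"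
    "\<And>s t. \<lbrakk>\<And>k. k \<in> \<K> \<Longrightarrow> s k \<in> k; \<And>k. k \<in> \<K> \<Longrightarrow> t k \<in> k\<rbrakk> \<Longrightarrow>
      (\<Sum>k\<in>\<K>. measure lborel k * (g (s k) - g (t k))) < e"
proof -
  obtain \<delta> where "\<delta> > 0" and \<delta>: "\<And>\<D>. \<D> tagged_division_of (cbox a b) \<Longrightarrow> (\<lambda>x. ball x \<delta>) fine \<D> \<Longrightarrow>
        \<bar>(\<Sum>(x, k)\<in>\<D>. measure lborel k * g x) - J\<bar> < e / 2"
    using riemann[unfolded riemann_sums_tendsto_def, rule_format, of "e / 2"] \<open>e > 0\<close> by auto
  \<comment> \<open>Half of \<open>\<delta>\<close>, so that a cell of the division is contained in the \<open>\<delta>\<close>-ball around any of its points.\<close>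
  obtain \<P> where \<P>: "\<P> tagged_division_of cbox a b" "(\<lambda>x. ball x (\<delta> / 2)) fine \<P>"
    using fine_division_exists[OF gauge_ball, of "\<delta> / 2" a b] \<open>\<delta> > 0\<close> by auto
  define \<K> where "\<K> = snd ` \<P>"
  have div: "\<K> division_of cbox a b"
    unfolding \<K>_def using division_of_tagged_division[OF \<P>(1)] .
  have sums: "\<bar>(\<Sum>k\<in>\<K>. measure lborel k * g (s k)) - J\<bar> < e / 2"
    if s: "\<And>k. k \<in> \<K> \<Longrightarrow> s k \<in> k" for s
  proof -
    define \<D> where "\<D> = (\<lambda>k. (s k, k)) ` \<K>"
    have "\<D> tagged_division_of cbox a b"
    proof (rule tagged_division_ofI)
      show "interior K1 \<inter> interior K2 = {}"
        if "(x1, K1) \<in> \<D>" "(x2, K2) \<in> \<D>" "(x1, K1) \<noteq> (x2, K2)" for x1 K1 x2 K2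
        using that division_ofD(5)[OF div, of K1 K2] by (auto simp: \<D>_def)
      have "{K. \<exists>x. (x, K) \<in> \<D>} = \<K>" by (auto simp: \<D>_def)
      then show "\<Union>{K. \<exists>x. (x, K) \<in> \<D>} = cbox a b" using division_ofD(6)[OF div] by simp
    qed (use s division_ofD(1,2,4)[OF div] in \<open>auto simp: \<D>_def\<close>)
    moreover have "(\<lambda>x. ball x \<delta>) fine \<D>"
    proof (rule fineI)
      fix z k assume "(z, k) \<in> \<D>"
      then have z: "z = s k" and k: "k \<in> \<K>" by (auto simp: \<D>_def)
      then obtain c where "(c, k) \<in> \<P>" by (auto simp: \<K>_def)
      then have "k \<subseteq> ball c (\<delta> / 2)" using \<P>(2) by (auto simp: fine_def)
      then show "k \<subseteq> ball z \<delta>"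
        using s[OF k] dist_triangle_half_r[of c z \<delta>] unfolding z
        by (metis dist_commute mem_ball subsetD subsetI)
    qed
    ultimately have "\<bar>(\<Sum>(x, k)\<in>\<D>. measure lborel k * g x) - J\<bar> < e / 2"
      by (rule \<delta>)
    also have "(\<Sum>(x, k)\<in>\<D>. measure lborel k * g x)
      = (\<Sum>k\<in>\<K>. measure lborel k * g (s k))"
      unfolding \<D>_def by (subst sum.reindex) (auto simp: inj_on_def)
    finally show ?thesis .
  qed
  show thesis
  proof (rule that[OF div])
    fix s t assume st: "\<And>k. k \<in> \<K> \<Longrightarrow> s k \<in> k" "\<And>k. k \<in> \<K> \<Longrightarrow> t k \<in> k"
    have "\<bar>(\<Sum>k\<in>\<K>. measure lborel k * g (s k)) - J\<bar> < e / 2"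
      "\<bar>(\<Sum>k\<in>\<K>. measure lborel k * g (t k)) - J\<bar> < e / 2"
      using sums st by blast+
    then
    show "(\<Sum>k\<in>\<K>. measure lborel k * (g (s k) - g (t k))) < e"
      unfolding right_diff_distrib sum_subtractf by argo
  qed
qed

text \<open>
  Moving a single tag within a cell of positive volume bounds the oscillation of \<open>g\<close> on that
  cell. Cells of volume zero say nothing about \<open>g\<close>, but they can be dropped: the
  others still cover the box.
\<close>

lemma riemann_sums_imp_bounded:
  fixes g :: "'a::euclidean_space \<Rightarrow> real"
  assumes riemann: "riemann_sums_tendsto g a b J"
    and ne: "box a b \<noteq> {}"
  shows "bounded (g ` cbox a b)"
proof -
  obtain \<K> where div: "\<K> division_of cbox a b"
    and osc: "\<And>s t. \<lbrakk>\<And>k. k \<in> \<K> \<Longrightarrow> s k \<in> k; \<And>k. k \<in> \<K> \<Longrightarrow> t k \<in> k\<rbrakk> \<Longrightarrow>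
      (\<Sum>k\<in>\<K>. measure lborel k * (g (s k) - g (t k))) < 1"
    by (rule riemann_sums_small_oscillation[OF riemann zero_less_one]) blast+
  have fin: "finite \<K>" using div by auto
  define \<K>' where "\<K>' = {k \<in> \<K>. measure lborel k \<noteq> 0}"
  have "measure lborel (cbox a b) \<noteq> 0"
    using ne by (simp add: content_eq_0_interior)
  then have div': "\<K>' division_of cbox a b"
    unfolding \<K>'_def by (rule division_of_nontrivial[OF div])
  have "bounded (g ` k)" if k: "k \<in> \<K>'" for k
  proof -
    obtain t where t: "\<And>k. k \<in> \<K> \<Longrightarrow> t k \<in> k"
      using division_ofD(3)[OF div] by (metis ex_in_conv)
    have kK: "k \<in> \<K>" and pos: "measure lborel k > 0"
      using k by (auto simp: \<K>'_def zero_less_measure_iff)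
    have diff: "measure lborel k * (g z - g z') < 1" if "z \<in> k" "z' \<in> k" for z z'
    proof -
      have "(\<Sum>l\<in>\<K>. measure lborel l * (g ((t(k := z)) l) - g ((t(k := z')) l)))
        = (\<Sum>l\<in>\<K>. if l = k then measure lborel k * (g z - g z') else 0)"
        by (intro sum.cong) auto
      also have "\<dots> = measure lborel k * (g z - g z')"
        using fin kK by simp
      finally show ?thesis
        using osc[of "t(k := z)" "t(k := z')"] t that by simp
    qed
    have *: "g z - g z' < 1 / measure lborel k" if "z \<in> k" "z' \<in> k" for z z'
      using diff[OF that] pos by (simp add: field_simps)
    have "\<bar>g z\<bar> \<le> \<bar>g (t k)\<bar> + 1 / measure lborel k" if "z \<in> k" for z
      using *[OF that t[OF kK]] *[OF t[OF kK] that] by linarith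
    then show ?thesis unfolding bounded_iff by auto
  qed
  moreover have "g ` cbox a b = (\<Union>k\<in>\<K>'. g ` k)"
    using division_ofD(6)[OF div'] by blast
  ultimately show ?thesis using fin by (auto simp: \<K>'_def)
qed

text \<open>
  A point in the interior of a cell at which \<open>g\<close> oscillates by \<open>c\<close> forces an oscillation by \<open>c\<close>
  within that cell. By Darboux's criterion with error \<open>c * e\<close> the cells of this kind have total
  volume below \<open>e\<close>, and the points on cell boundaries are negligible.
\<close>

lemma negligible_oscillation:
  fixes g :: "'a::euclidean_space \<Rightarrow> real"
  assumes riemann: "riemann_sums_tendsto g a b J"
    and "c > 0"
  shows "negligible {z \<in> cbox a b. \<forall>U. open U \<longrightarrow> z \<in> U \<longrightarrow> (\<exists>s\<in>U. \<exists>t\<in>U. g s - g t \<ge> c)}" (is "negligible ?E")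
  unfolding negligible_outer_le
proof (intro allI impI)
  fix e :: real assume "e > 0"
  obtain \<K> where div: "\<K> division_of cbox a b"
    and osc: "\<And>s t. \<lbrakk>\<And>k. k \<in> \<K> \<Longrightarrow> s k \<in> k; \<And>k. k \<in> \<K> \<Longrightarrow> t k \<in> k\<rbrakk> \<Longrightarrow>
      (\<Sum>k\<in>\<K>. measure lborel k * (g (s k) - g (t k))) < c * e"
    by (rule riemann_sums_small_oscillation[OF riemann mult_pos_pos[OF \<open>c > 0\<close> \<open>e > 0\<close>]]) blast+
  have fin: "finite \<K>" using div by auto
  have cell: "\<exists>a b. k = cbox a b" "k \<noteq> {}" if "k \<in> \<K>" for k
    using division_ofD[OF div] that by auto
  have leb: "k \<in> lmeasurable" "measure lebesgue k = measure lborel k"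
    if "k \<in> \<K>" for k
    using cell(1)[OF that] by auto
  define Q where "Q = {k \<in> \<K>. \<exists>s\<in>k. \<exists>t\<in>k. g s - g t \<ge> c}"
  have QK: "Q \<subseteq> \<K>" and finQ: "finite Q" using fin by (auto simp: Q_def)
  \<comment> \<open>Tags realising the oscillation on the cells in \<open>Q\<close>, and equal tags, which cancel, elsewhere.\<close>
  have "\<forall>k\<in>\<K>. \<exists>s t. s \<in> k \<and> t \<in> k \<and> (if k \<in> Q then g s - g t \<ge> c else g s - g t = 0)"
  proof
    fix k assume "k \<in> \<K>"
    then show "\<exists>s t. s \<in> k \<and> t \<in> k \<and> (if k \<in> Q then g s - g t \<ge> c else g s - g t = 0)"
      using cell(2)[of k] by (cases "k \<in> Q") (auto simp: Q_def)
  qed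
  then obtain s t where st: "\<And>k. k \<in> \<K> \<Longrightarrow> s k \<in> k" "\<And>k. k \<in> \<K> \<Longrightarrow> t k \<in> k"
    "\<And>k. k \<in> \<K> \<Longrightarrow> if k \<in> Q then g (s k) - g (t k) \<ge> c else g (s k) - g (t k) = 0"
    by metis
  have "c * (\<Sum>k\<in>Q. measure lborel k)
    = (\<Sum>k\<in>Q. measure lborel k * c)"
    by (simp add: sum_distrib_left mult.commute)
  also have "\<dots> \<le> (\<Sum>k\<in>Q. measure lborel k * (g (s k) - g (t k)))"
    using st(3) QK by (intro sum_mono mult_left_mono) (auto split: if_splits)
  also have "\<dots> = (\<Sum>k\<in>\<K>. measure lborel k * (g (s k) - g (t k)))"
    using st(3) QK fin by (intro sum.mono_neutral_left) auto
  also have "\<dots> < c * e" using st(1,2) by (rule osc)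
  finally have small: "(\<Sum>k\<in>Q. measure lborel k) < e"
    using \<open>c > 0\<close> by simp
  define T where "T = \<Union>Q \<union> (\<Union>k\<in>\<K>. frontier k)"
  have negl: "negligible (\<Union>k\<in>\<K>. frontier k)"
  proof (rule negligible_Union)
    show "negligible A" if "A \<in> frontier ` \<K>" for A
      using that cell(1) by (metis imageE convex_box(1) negligible_convex_frontier)
  qed (use fin in auto)
  have UQ: "\<Union>Q \<in> lmeasurable"
    using leb(1) QK finQ by (intro fmeasurable.finite_Union) auto
  show "\<exists>T. ?E \<subseteq> T \<and> T \<in> lmeasurable \<and> measure lebesgue T \<le> e"
  proof (intro exI conjI)
    show "T \<in> lmeasurable"
      unfolding T_def using UQ negligible_imp_measurable[OF negl] by (rule fmeasurable.Un)
    have "measure lebesgue T \<le> measure lebesgue (\<Union>Q) + measure lebesgue (\<Union>k\<in>\<K>. frontier k)"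
      unfolding T_def using UQ negligible_imp_measurable[OF negl] by (intro measure_Un_le) auto
    also have "\<dots> = measure lebesgue (\<Union>Q)"
      using negligible_imp_measure0[OF negl] by simp
    also have "\<dots> \<le> (\<Sum>k\<in>Q. measure lebesgue k)"
      using measure_UNION_le[OF finQ, of "\<lambda>k. k" lebesgue] leb(1) QK by (auto simp: fmeasurableD subset_iff)
    also have "\<dots> = (\<Sum>k\<in>Q. measure lborel k)"
      using leb(2) QK by (intro sum.cong) auto
    also note small
    finally show "measure lebesgue T \<le> e" by simp
    show "?E \<subseteq> T"
    proof
      fix z assume z: "z \<in> ?E"
      then have "z \<in> \<Union>\<K>" using division_ofD(6)[OF div] by auto
      then obtain k where k: "k \<in> \<K>" "z \<in> k" by auto
      show "z \<in> T"
      proof (cases "z \<in> frontier k")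
        case False
        then have "z \<in> interior k" using k closure_subset by (auto simp: frontier_def)
        then obtain s t where "s \<in> interior k" "t \<in> interior k" "g s - g t \<ge> c"
          using z open_interior by blast
        then have "k \<in> Q" using k interior_subset by (force simp: Q_def)
        then show ?thesis using k by (auto simp: T_def)
      qed (use k in \<open>auto simp: T_def\<close>)
    qed
  qed
qed

lemma riemann_sums_imp_negligible_discontinuities:
  fixes g :: "'a::euclidean_space \<Rightarrow> real"
  assumes riemann: "riemann_sums_tendsto g a b J"
  shows "negligible {z \<in> cbox a b. \<not> isCont g z}"
proof -
  define E where "E c = {z \<in> cbox a b. \<forall>U. open U \<longrightarrow> z \<in> U \<longrightarrow> (\<exists>s\<in>U. \<exists>t\<in>U. g s - g t \<ge> c)}" for c
  have "negligible (\<Union>n. E (1 / real (Suc n)))"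
  proof (rule negligible_Union_nat)
    show "negligible (E (1 / real (Suc n)))" for n
      unfolding E_def by (rule negligible_oscillation[OF riemann]) auto
  qed
  moreover have "{z \<in> cbox a b. \<not> isCont g z} \<subseteq> (\<Union>n. E (1 / real (Suc n)))"
  proof clarify
    fix z assume z: "z \<in> cbox a b" "\<not> isCont g z"
    show "z \<in> (\<Union>n. E (1 / real (Suc n)))"
    proof (rule ccontr)
      assume notE: "z \<notin> (\<Union>n. E (1 / real (Suc n)))"
      have "isCont g z"
        unfolding continuous_at_eps_delta
      proof (intro allI impI)
        fix e :: real assume "e > 0"
        then obtain n where n: "1 / real (Suc n) < e"
          using nat_approx_posE by blast
        obtain U where U: "open U" "z \<in> U" "\<And>s t. s \<in> U \<Longrightarrow> t \<in> U \<Longrightarrow> g s - g t < 1 / real (Suc n)"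
        proof -
          have "z \<notin> E (1 / real (Suc n))" using notE by blast
          then obtain U where "open U" "z \<in> U" "\<not> (\<exists>s\<in>U. \<exists>t\<in>U. g s - g t \<ge> 1 / real (Suc n))"
            using z(1) unfolding E_def by blast
          then show ?thesis by (intro that[of U]) (use not_le in blast)+
        qed
        obtain \<delta> where "\<delta> > 0" "ball z \<delta> \<subseteq> U" using U open_contains_ball by blast
        moreover have "dist (g s) (g z) < e" if "s \<in> U" for s
          using U(3)[OF that U(2)] U(3)[OF U(2) that] n by (simp add: dist_real_def)
        ultimately show "\<exists>d>0. \<forall>x'. dist x' z < d \<longrightarrow> dist (g x') (g z) < e"
          by (metis dist_commute mem_ball subsetD)
      qed
      with z show False by simp
    qed
  qed
  ultimately show ?thesis by (rule negligible_subset)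
qed

text \<open>
  Off a null set the function is continuous on the remaining set, hence measurable there, and
  Lebesgue measure is complete.
\<close>

lemma borel_measurable_AE_continuous:
  fixes f :: "'a::euclidean_space \<Rightarrow> real"
  assumes S: "S \<in> sets lebesgue" and cont: "AE z in lebesgue_on S. continuous (at z within S) f"
  shows "f \<in> borel_measurable (lebesgue_on S)"
proof -
  have "AE z in lebesgue. z \<in> S \<longrightarrow> continuous (at z within S) f"
    using cont S by (subst (asm) AE_restrict_space_iff) auto
  then obtain N where N: "N \<in> null_sets lebesgue"
    and sub: "{z. \<not> (z \<in> S \<longrightarrow> continuous (at z within S) f)} \<subseteq> N"
    by (auto simp: eventually_ae_filter)
  have "continuous (at z within S - N) f" if "z \<in> S - N" for z
    using that sub by (intro continuous_within_subset[of z S f "S - N"]) auto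
  then have "continuous_on (S - N) f"
    by (simp add: continuous_on_eq_continuous_within)
  then have "f \<in> borel_measurable (lebesgue_on (S - N))"
    using S N by (intro continuous_imp_measurable_on_sets_lebesgue) auto
  then have "f \<in> borel_measurable (lebesgue_on (S - N \<inter> S))"
    by (simp add: Diff_Int)
  moreover have "N \<inter> S \<in> null_sets (lebesgue_on S)"
    using N S by (simp add: null_sets_restrict_space null_set_Int2)
  ultimately show ?thesis using borel_measurable_diff_null S by metis
qed

text \<open>
  The half of Lebesgue's criterion for Riemann integrability that turns a Riemann integrable weight
  into an admissible test function for equidistribution.
\<close>

lemma riemann_integrable_on_properties:
  fixes f :: "'a::euclidean_space \<Rightarrow> real"
  assumes R: "f riemann_integrable_on S" and S: "S \<in> sets lebesgue"
  shows riemann_integrable_on_imp_bounded: "bounded (f ` S)"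
    and riemann_integrable_on_imp_AE_continuous: "AE z in lebesgue_on S. continuous (at z within S) f"
proof -
  define g where "g z = (if z \<in> S then f z else 0)" for z
  obtain a b J where sub: "S \<subseteq> box a b" and riemann: "riemann_sums_tendsto g a b J"
    using R unfolding riemann_integrable_on_def riemann_sums_tendsto_def g_def by blast
  have subc: "S \<subseteq> cbox a b" using sub box_subset_cbox by blast
  show "bounded (f ` S)"
  proof (cases "box a b = {}")
    case False
    have "f ` S \<subseteq> g ` cbox a b" using subc by (auto simp: g_def intro!: image_eqI)
    then show ?thesis
      using riemann_sums_imp_bounded[OF riemann False] bounded_subset by blast
  qed (use sub in auto)
  have "continuous (at z within S) f" if "z \<in> S" "isCont g z" for z
  proof (rule continuous_transform_within[OF continuous_at_imp_continuous_at_within[OF that(2)], of 1])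
    show "g z' = f z'" if "z' \<in> S" for z' using that by (simp add: g_def)
  qed (use that in auto)
  moreover have "AE z in lebesgue. z \<notin> {z \<in> cbox a b. \<not> isCont g z}"
    using riemann_sums_imp_negligible_discontinuities[OF riemann]
    by (intro AE_not_in) (simp add: negligible_iff_null_sets)
  ultimately have "AE z in lebesgue. z \<in> S \<longrightarrow> continuous (at z within S) f"
    using subc by (auto elim!: eventually_mono)
  then show "AE z in lebesgue_on S. continuous (at z within S) f"
    using S by (subst AE_restrict_space_iff) auto
qed

section \<open>Linear systems with positive definite limit\<close>

text \<open>
  Gaussian elimination, carried out on the limit system and on the approximating systems in
  parallel. Positive definiteness makes the last diagonal entry \<open>a\<close> a nonzero pivot, and it passes
  to the Schur complement \<open>A'\<close>, because a vector \<open>v\<close> extended by the entry \<open>- t / a\<close> annihilates the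
  last row and has the same value in the quadratic form. Since \<open>a\<close> is the limit of the
  approximating pivots, these are eventually nonzero as well. The solution \<open>c\<close> of the limit system
  enters only through the limit of the right-hand sides.
\<close>

lemma positive_definite_solution_tendsto:
  fixes A :: "nat \<Rightarrow> nat \<Rightarrow> real" and AF :: "'b \<Rightarrow> nat \<Rightarrow> nat \<Rightarrow> real"
  assumes "\<And>i j. i < m \<Longrightarrow> j < m \<Longrightarrow> ((\<lambda>t. AF t i j) \<longlongrightarrow> A i j) F"
    and "\<And>i. i < m \<Longrightarrow> ((\<lambda>t. h t i) \<longlongrightarrow> (\<Sum>j<m. A i j * c j)) F"
    and "\<And>v i. i < m \<Longrightarrow> v i \<noteq> 0 \<Longrightarrow> (\<Sum>i<m. v i * (\<Sum>j<m. A i j * v j)) > 0"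
  shows "\<exists>cF. (\<forall>j<m. ((\<lambda>t. cF t j) \<longlongrightarrow> c j) F) \<and>
    (\<forall>\<^sub>F t in F. \<forall>i<m. (\<Sum>j<m. AF t i j * cF t j) = h t i)"
  using assms
proof (induction m arbitrary: A AF h)
  case 0
  show ?case by simp
next
  case (Suc m)
  note A = Suc.prems(1) and h = Suc.prems(2) and pd = Suc.prems(3)
  define a where "a = A m m"
  have "(\<Sum>i<Suc m. (if i = m then 1 else 0) * (\<Sum>j<Suc m. A i j * (if j = m then 1 else 0))) > 0"
    by (rule pd[of m]) auto
  then have a: "a > 0" by (simp add: a_def)
  define A' where "A' i j = A i j - A i m * A m j / a" for i j
  define AF' where "AF' t i j = AF t i j - AF t i m * AF t m j / AF t m m" for t i j
  define h' where "h' t i = h t i - AF t i m * h t m / AF t m m" for t i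
  have "\<exists>cF. (\<forall>j<m. ((\<lambda>t. cF t j) \<longlongrightarrow> c j) F) \<and>
    (\<forall>\<^sub>F t in F. \<forall>i<m. (\<Sum>j<m. AF' t i j * cF t j) = h' t i)"
  proof (rule Suc.IH)
    show "((\<lambda>t. AF' t i j) \<longlongrightarrow> A' i j) F" if "i < m" "j < m" for i j
      unfolding AF'_def A'_def a_def using that a by (intro tendsto_intros A) (auto simp: a_def)
    show "((\<lambda>t. h' t i) \<longlongrightarrow> (\<Sum>j<m. A' i j * c j)) F" if "i < m" for i
    proof -
      have "((\<lambda>t. h' t i) \<longlongrightarrow> (\<Sum>j<Suc m. A i j * c j) - A i m * (\<Sum>j<Suc m. A m j * c j) / A m m) F"
        unfolding h'_def using that a by (intro tendsto_intros A h) (auto simp: a_def)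
      also have "(\<Sum>j<Suc m. A i j * c j) - A i m * (\<Sum>j<Suc m. A m j * c j) / A m m = (\<Sum>j<m. A' i j * c j)"
        using a by (simp add: A'_def a_def[symmetric] left_diff_distrib sum_subtractf sum_divide_distrib
            sum_distrib_left algebra_simps add_divide_distrib)
      finally show ?thesis .
    qed
    show "(\<Sum>i<m. v i * (\<Sum>j<m. A' i j * v j)) > 0" if "i < m" "v i \<noteq> 0" for v i
    proof -
      define t where "t = (\<Sum>j<m. A m j * v j)"
      define v' where "v' = v(m := - t / a)"
      have "(\<Sum>i<Suc m. v' i * (\<Sum>j<Suc m. A i j * v' j)) > 0"
        using that by (intro pd[of i]) (auto simp: v'_def)
      also have "(\<lambda>i. \<Sum>j<Suc m. A i j * v' j) = (\<lambda>i. (\<Sum>j<m. A i j * v j) - A i m * t / a)"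
        by (simp add: v'_def)
      also have "(\<Sum>i<Suc m. v' i * ((\<Sum>j<m. A i j * v j) - A i m * t / a))
        = (\<Sum>i<m. v i * ((\<Sum>j<m. A i j * v j) - A i m * t / a))"
        using a by (simp add: v'_def t_def[symmetric] a_def[symmetric])
      also have "(\<lambda>i. (\<Sum>j<m. A i j * v j) - A i m * t / a) = (\<lambda>i. \<Sum>j<m. A' i j * v j)"
        by (simp add: A'_def t_def left_diff_distrib sum_subtractf sum_divide_distrib sum_distrib_left mult.assoc)
      finally show ?thesis .
    qed
  qed
  then obtain cF where lim: "\<And>j. j < m \<Longrightarrow> ((\<lambda>t. cF t j) \<longlongrightarrow> c j) F"
    and sol: "\<forall>\<^sub>F t in F. \<forall>i<m. (\<Sum>j<m. AF' t i j * cF t j) = h' t i"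
    by blast
  define q where "q t = (h t m - (\<Sum>j<m. AF t m j * cF t j)) / AF t m m" for t
  have "(q \<longlongrightarrow> ((\<Sum>j<Suc m. A m j * c j) - (\<Sum>j<m. A m j * c j)) / A m m) F"
    unfolding q_def using a by (intro tendsto_intros A h lim) (auto simp: a_def)
  then have q: "(q \<longlongrightarrow> c m) F" using a by (simp add: a_def)
  have "((\<lambda>t. AF t m m) \<longlongrightarrow> a) F" unfolding a_def by (rule A) auto
  then have "\<forall>\<^sub>F t in F. AF t m m > 0"
    using a by (rule order_tendstoD)
  then have "\<forall>\<^sub>F t in F. \<forall>i<Suc m. (\<Sum>j<Suc m. AF t i j * ((cF t)(m := q t)) j) = h t i"
    using sol
  proof eventually_elim
    case (elim t)
    have row: "(\<Sum>j<Suc m. AF t i j * ((cF t)(m := q t)) j) = (\<Sum>j<m. AF t i j * cF t j) + AF t i m * q t" for i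
      by simp
    have "(\<Sum>j<m. AF t i j * cF t j) + AF t i m * q t = h t i" if "i < m" for i
    proof -
      have "(\<Sum>j<m. AF t i j * cF t j) - AF t i m * (\<Sum>j<m. AF t m j * cF t j) / AF t m m = h' t i"
        using elim(2) that by (simp add: AF'_def left_diff_distrib sum_subtractf sum_divide_distrib
            sum_distrib_left mult.assoc)
      then show ?thesis by (simp add: h'_def q_def algebra_simps diff_divide_distrib)
    qed
    moreover have "(\<Sum>j<m. AF t m j * cF t j) + AF t m m * q t = h t m"
      using elim(1) by (simp add: q_def)
    ultimately show ?case unfolding row by (auto simp: less_Suc_eq)
  qed
  then show ?case
    using lim q by (intro exI[of _ "\<lambda>t. (cF t)(m := q t)"]) (auto simp: less_Suc_eq)
qed

section \<open>Least-squares weights as values of a function\<close>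

text \<open>
  If the weights have the form \<open>r n * u (x n)\<close> with \<open>u\<close> in the space of exactness \<open>F\<close>, then
  \<open>R\<^bsup>-1\<^esup>w\<close> is the vector of values of \<open>u\<close>, and every difference of two exact weight vectors is
  orthogonal to it. By Pythagoras \<open>w\<close> is then the unique minimiser.
\<close>

lemma least_squares_weights_iff:
  assumes r: "\<And>n. n < N \<Longrightarrow> r n > 0" and u: "u \<in> F"
    and w_def: "w = (\<lambda>n\<in>{..<N}. r n * u (x n))" and w: "w \<in> exact_weights F I x N"
  shows "is_least_squares_weights (exact_weights F I x N) r N v \<longleftrightarrow> v = w"
proof -
  define Q where "Q v = (\<Sum>n<N. (v n)\<^sup>2 / r n)" for v :: "nat \<Rightarrow> real"
  have norm: "L2_set (\<lambda>n. 1 / sqrt (r n) * v n) {..<N} = sqrt (Q v)" for v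
    unfolding L2_set_def Q_def using r
    by (intro arg_cong[where f = sqrt] sum.cong) (auto simp: power_mult_distrib power_divide less_imp_le)
  have pythagoras: "Q v = Q w + (\<Sum>n<N. (v n - w n)\<^sup>2 / r n)" if "v \<in> exact_weights F I x N" for v
  proof -
    have "(\<Sum>n<N. v n * u (x n)) = (\<Sum>n<N. w n * u (x n))"
      using that w u unfolding exact_weights_def by auto
    moreover have "(v n)\<^sup>2 / r n = (w n)\<^sup>2 / r n + (v n - w n)\<^sup>2 / r n + 2 * (v n * u (x n) - w n * u (x n))"
      if "n < N" for n
      using r[OF that] that by (simp add: w_def field_simps power2_eq_square)
    ultimately show ?thesis
      unfolding Q_def by (simp add: sum.distrib sum_subtractf sum_distrib_left[symmetric])
  qed
  have nonneg: "(\<Sum>n<N. (v n - w n)\<^sup>2 / r n) \<ge> 0" for v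
    using r by (intro sum_nonneg) (auto simp: less_imp_le)
  show ?thesis
  proof
    assume "v = w"
    have "Q w \<le> Q v" if "v \<in> exact_weights F I x N" for v
      using pythagoras[OF that] nonneg[of v] by linarith
    then show "is_least_squares_weights (exact_weights F I x N) r N v"
      using w \<open>v = w\<close> unfolding is_least_squares_weights_def is_arg_min_def norm
      by (auto simp: not_less)
  next
    assume ls: "is_least_squares_weights (exact_weights F I x N) r N v"
    then have v: "v \<in> exact_weights F I x N" and "Q v \<le> Q w"
      using w unfolding is_least_squares_weights_def is_arg_min_def norm by (auto simp: not_less)
    then have "(\<Sum>n<N. (v n - w n)\<^sup>2 / r n) = 0" using pythagoras[OF v] nonneg[of v] by linarith
    then have "\<forall>n\<in>{..<N}. (v n - w n)\<^sup>2 / r n = 0"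
      using r by (subst (asm) sum_nonneg_eq_0_iff) (auto simp: less_imp_le)
    then have eq: "v n = w n" if "n < N" for n using that r[OF that] by fastforce
    have "v \<in> extensional {..<N}" "w \<in> extensional {..<N}"
      using v w unfolding exact_weights_def PiE_def by blast+
    then show "v = w" using eq by (intro extensionalityI) auto
  qed
qed

section \<open>The space of radial basis functions\<close>

lemma rbf_fun_sum:
  fixes c :: "nat \<Rightarrow> real"
  shows
  "rbf_fun \<phi> M \<epsilon> y K p (\<lambda>i. \<Sum>l<L. c l * \<alpha> l i) (\<lambda>k. \<Sum>l<L. c l * \<beta> l k) z
    = (\<Sum>l<L. c l * rbf_fun \<phi> M \<epsilon> y K p (\<alpha> l) (\<beta> l) z)"
proof -
  have *: "(\<Sum>i<n. (\<Sum>l<L. c l * a l i) * t i) = (\<Sum>l<L. c l * (\<Sum>i<n. a l i * t i))"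
    for n :: nat and a :: "nat \<Rightarrow> nat \<Rightarrow> real" and t :: "nat \<Rightarrow> real"
    unfolding sum_distrib_left sum_distrib_right by (subst sum.swap) (simp add: mult.assoc)
  show ?thesis unfolding rbf_fun_def * by (simp add: sum.distrib distrib_left)
qed

lemma moment_conditions_sum:
  assumes "\<And>l. l < L \<Longrightarrow> moment_conditions M y K p (\<alpha> l)"
  shows "moment_conditions M y K p (\<lambda>i. \<Sum>l<L. c l * \<alpha> l i)"
  unfolding moment_conditions_def
proof (intro allI impI)
  fix k assume "k < K"
  have "(\<Sum>i<M. (\<Sum>l<L. c l * \<alpha> l i) * p k (y i)) = (\<Sum>l<L. c l * (\<Sum>i<M. \<alpha> l i * p k (y i)))"
    unfolding sum_distrib_left sum_distrib_right by (subst sum.swap) (simp add: mult.assoc)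
  also have "\<dots> = 0" using assms \<open>k < K\<close> by (simp add: moment_conditions_def)
  finally show "(\<Sum>i<M. (\<Sum>l<L. c l * \<alpha> l i) * p k (y i)) = 0" .
qed

lemma rbf_space_sum:
  fixes c :: "nat \<Rightarrow> real"
  assumes "\<And>l. l < L \<Longrightarrow> b l \<in> rbf_space \<Omega> \<phi> M \<epsilon> y K p"
  shows "(\<lambda>z. \<Sum>l<L. c l * b l z) \<in> rbf_space \<Omega> \<phi> M \<epsilon> y K p"
proof -
  have "\<forall>l. \<exists>\<alpha> \<beta>. l < L \<longrightarrow> moment_conditions M y K p \<alpha> \<and> (\<forall>z\<in>\<Omega>. b l z = rbf_fun \<phi> M \<epsilon> y K p \<alpha> \<beta> z)"
    using assms by (auto simp: rbf_space_def)
  then obtain \<alpha> \<beta> where "\<And>l. l < L \<Longrightarrow> moment_conditions M y K p (\<alpha> l)"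
    "\<And>l z. l < L \<Longrightarrow> z \<in> \<Omega> \<Longrightarrow> b l z = rbf_fun \<phi> M \<epsilon> y K p (\<alpha> l) (\<beta> l) z"
    by metis
  then have "moment_conditions M y K p (\<lambda>i. \<Sum>l<L. c l * \<alpha> l i) \<and> (\<forall>z\<in>\<Omega>. (\<Sum>l<L. c l * b l z)
    = rbf_fun \<phi> M \<epsilon> y K p (\<lambda>i. \<Sum>l<L. c l * \<alpha> l i) (\<lambda>k. \<Sum>l<L. c l * \<beta> l k) z)"
    by (simp add: moment_conditions_sum rbf_fun_sum)
  then show ?thesis
    unfolding rbf_space_def by blast
qed

text \<open>
  The basis consists of the cardinal functions, which interpolate the unit vectors at the centers.
  An element of the space has the same values at the centers as the combination of
  cardinal functions with these values as coefficients, so the two agree by unique solvability.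
\<close>

lemma rbf_space_cardinal_basis:
  assumes solvable: "uniquely_solvable \<phi> M \<epsilon> y K p"
    and centers: "\<And>m. m < M \<Longrightarrow> y m \<in> \<Omega>"
  obtains b where "basis_on \<Omega> M b (rbf_space \<Omega> \<phi> M \<epsilon> y K p)"
proof -
  have "\<forall>m. \<exists>\<alpha> \<beta>. moment_conditions M y K p \<alpha> \<and>
    (\<forall>l<M. rbf_fun \<phi> M \<epsilon> y K p \<alpha> \<beta> (y l) = (if l = m then 1 else 0))"
  proof
    fix m
    show "\<exists>\<alpha> \<beta>. moment_conditions M y K p \<alpha> \<and>
      (\<forall>l<M. rbf_fun \<phi> M \<epsilon> y K p \<alpha> \<beta> (y l) = (if l = m then 1 else 0))"
      using solvable[unfolded uniquely_solvable_def, rule_format, of "\<lambda>l. if l = m then 1 else 0"]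
      by blast
  qed
  then obtain \<alpha> \<beta> where mom: "\<And>m. moment_conditions M y K p (\<alpha> m)"
    and val: "\<And>m l. l < M \<Longrightarrow> rbf_fun \<phi> M \<epsilon> y K p (\<alpha> m) (\<beta> m) (y l) = (if l = m then 1 else 0)"
    by metis
  define b where "b m = rbf_fun \<phi> M \<epsilon> y K p (\<alpha> m) (\<beta> m)" for m
  have b: "b m \<in> rbf_space \<Omega> \<phi> M \<epsilon> y K p" for m
    using mom by (auto simp: rbf_space_def b_def)
  have at_center: "(\<Sum>m<M. c m * b m (y l)) = c l" if "l < M" for c l
  proof -
    have "(\<Sum>m<M. c m * b m (y l)) = (\<Sum>m<M. if m = l then c l else 0)"
      using that by (intro sum.cong) (auto simp: b_def val)
    then show ?thesis using that by simp
  qed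
  have span: "s z = (\<Sum>m<M. s (y m) * b m z)" if s: "s \<in> rbf_space \<Omega> \<phi> M \<epsilon> y K p" and z: "z \<in> \<Omega>" for s z
  proof -
    obtain \<alpha>s \<beta>s where mom_s: "moment_conditions M y K p \<alpha>s"
      and s_eq: "\<And>z. z \<in> \<Omega> \<Longrightarrow> s z = rbf_fun \<phi> M \<epsilon> y K p \<alpha>s \<beta>s z"
      using s by (auto simp: rbf_space_def)
    define \<alpha>t where "\<alpha>t i = (\<Sum>m<M. s (y m) * \<alpha> m i)" for i
    define \<beta>t where "\<beta>t k = (\<Sum>m<M. s (y m) * \<beta> m k)" for k
    have t_eq: "rbf_fun \<phi> M \<epsilon> y K p \<alpha>t \<beta>t z = (\<Sum>m<M. s (y m) * b m z)" for z
      unfolding \<alpha>t_def \<beta>t_def b_def by (rule rbf_fun_sum)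
    have mom_t: "moment_conditions M y K p \<alpha>t"
      unfolding \<alpha>t_def using mom by (rule moment_conditions_sum)
    \<comment> \<open>Uniqueness of the coefficients is stated for extensional families, so both families are
      truncated by \<open>R\<close>, which leaves the function unchanged.\<close>
    define R where "R a b = (restrict a {..<M}, restrict b {..<K})" for a b :: "nat \<Rightarrow> real"
    have rbf_R: "rbf_fun \<phi> M \<epsilon> y K p (fst (R a b)) (snd (R a b)) = rbf_fun \<phi> M \<epsilon> y K p a b" for a b
      by (simp add: R_def rbf_fun_def fun_eq_iff)
    have mom_R: "moment_conditions M y K p (fst (R a b)) = moment_conditions M y K p a" for a b
      by (simp add: R_def moment_conditions_def)
    have R_in: "R a b \<in> ({..<M} \<rightarrow>\<^sub>E UNIV) \<times> ({..<K} \<rightarrow>\<^sub>E UNIV)" for a b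
      by (auto simp: R_def)
    have uniq: "\<exists>!ab. ab \<in> ({..<M} \<rightarrow>\<^sub>E UNIV) \<times> ({..<K} \<rightarrow>\<^sub>E UNIV) \<and>
      moment_conditions M y K p (fst ab) \<and>
      (\<forall>m<M. rbf_fun \<phi> M \<epsilon> y K p (fst ab) (snd ab) (y m) = s (y m))"
      using solvable unfolding uniquely_solvable_def by (rule allE)
    have "R \<alpha>s \<beta>s = R \<alpha>t \<beta>t"
    proof (rule ex1E[OF uniq], elim conjE)
      fix ab
      assume all: "\<forall>cd. cd \<in> ({..<M} \<rightarrow>\<^sub>E UNIV) \<times> ({..<K} \<rightarrow>\<^sub>E UNIV) \<and>
        moment_conditions M y K p (fst cd) \<and>
        (\<forall>m<M. rbf_fun \<phi> M \<epsilon> y K p (fst cd) (snd cd) (y m) = s (y m)) \<longrightarrow> cd = ab"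
      have "R \<alpha>s \<beta>s = ab"
        using R_in mom_s s_eq centers by (intro all[rule_format]) (simp add: rbf_R mom_R)
      moreover have "R \<alpha>t \<beta>t = ab"
        using R_in mom_t at_center by (intro all[rule_format]) (simp add: rbf_R mom_R t_eq)
      ultimately show ?thesis by simp
    qed
    then have "rbf_fun \<phi> M \<epsilon> y K p \<alpha>s \<beta>s z = rbf_fun \<phi> M \<epsilon> y K p \<alpha>t \<beta>t z"
      using rbf_R[of \<alpha>s \<beta>s] rbf_R[of \<alpha>t \<beta>t] by simp
    then show ?thesis using s_eq[OF z] t_eq by simp
  qed
  have "basis_on \<Omega> M b (rbf_space \<Omega> \<phi> M \<epsilon> y K p)"
    unfolding basis_on_def
  proof (intro conjI allI impI ballI)
    show "\<exists>c. \<forall>z\<in>\<Omega>. s z = (\<Sum>m<M. c m * b m z)" if "s \<in> rbf_space \<Omega> \<phi> M \<epsilon> y K p" for s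
      using span[OF that] by (intro exI[of _ "\<lambda>m. s (y m)"] ballI)
    show "c m = 0" if "\<forall>z\<in>\<Omega>. (\<Sum>m<M. c m * b m z) = 0" "m < M" for c m
      using that centers at_center[of m c] by simp
  qed (rule b)
  then show thesis by (rule that)
qed

lemma continuous_on_polys_on: "f \<in> polys_on \<Omega> d \<Longrightarrow> continuous_on \<Omega> f"
proof -
  assume "f \<in> polys_on \<Omega> d"
  then obtain c where "\<And>z. z \<in> \<Omega> \<Longrightarrow> f z = (\<Sum>a | (\<Sum>i\<in>UNIV. a i) \<le> d. c a * (\<Prod>i\<in>UNIV. (z $ i) ^ a i))"
    by (auto simp: polys_on_def)
  moreover have "continuous_on \<Omega> (\<lambda>z. \<Sum>a | (\<Sum>i\<in>UNIV. a i) \<le> d. c a * (\<Prod>i\<in>UNIV. (z $ i) ^ a i))"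
    by (intro continuous_intros)
  ultimately show ?thesis by (simp cong: continuous_on_cong)
qed

text \<open>
  The set of exponents has to be finite, as a sum over an infinite set would be \<open>0\<close>.
\<close>

lemma one_in_polys_on:
  fixes \<Omega> :: "(real ^ 'n) set"
  shows "(\<lambda>_. 1) \<in> polys_on \<Omega> d"
proof -
  let ?A = "{a :: 'n \<Rightarrow> nat. (\<Sum>i\<in>UNIV. a i) \<le> d}"
  have "?A \<subseteq> Pi\<^sub>E UNIV (\<lambda>_. {..d})"
  proof
    fix a :: "'n \<Rightarrow> nat" assume "a \<in> ?A"
    then have "a i \<le> d" for i using member_le_sum[of i UNIV a] by simp
    then show "a \<in> Pi\<^sub>E UNIV (\<lambda>_. {..d})" by auto
  qed
  then have fin: "finite ?A" by (rule finite_subset) (simp add: finite_PiE)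
  have "(\<Sum>a\<in>?A. (if a = (\<lambda>_. 0) then 1 else 0) * (\<Prod>i\<in>UNIV. (z $ i) ^ a i)) = (1::real)" for z :: "real ^ 'n"
  proof -
    have "(\<Sum>a\<in>?A. (if a = (\<lambda>_. 0) then 1 else 0) * (\<Prod>i\<in>UNIV. (z $ i) ^ a i))
      = (\<Sum>a\<in>?A. if a = (\<lambda>_. 0) then 1 else (0::real))"
      by (intro sum.cong) auto
    then show ?thesis using fin by simp
  qed
  then show ?thesis unfolding polys_on_def mem_Collect_eq
    by (intro exI[of _ "\<lambda>a. if a = (\<lambda>_. 0) then 1 else 0"]) simp
qed

lemma continuous_on_rbf_space:
  assumes s: "s \<in> rbf_space \<Omega> \<phi> M \<epsilon> y K p"
    and \<phi>: "continuous_on {0..} \<phi>" and \<epsilon>: "\<And>m. m < M \<Longrightarrow> \<epsilon> m \<ge> 0"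
    and p: "\<And>k. k < K \<Longrightarrow> continuous_on \<Omega> (p k)"
  shows "continuous_on \<Omega> s"
proof -
  obtain \<alpha> \<beta> where eq: "\<And>z. z \<in> \<Omega> \<Longrightarrow> s z = rbf_fun \<phi> M \<epsilon> y K p \<alpha> \<beta> z"
    using s by (auto simp: rbf_space_def)
  have "continuous_on \<Omega> (\<lambda>z. \<phi> (\<epsilon> m * norm (z - y m)))" if "m < M" for m
    using \<epsilon>[OF that] by (intro continuous_on_compose2[OF \<phi>] continuous_intros) auto
  then have "continuous_on \<Omega> (rbf_fun \<phi> M \<epsilon> y K p \<alpha> \<beta>)"
    unfolding rbf_fun_def using p by (intro continuous_intros) auto
  then show ?thesis using eq by (simp cong: continuous_on_cong)
qed

lemma one_in_rbf_space:
  assumes basis: "basis_on \<Omega> K p (polys_on \<Omega> d)"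
  shows "(\<lambda>_. 1) \<in> rbf_space \<Omega> \<phi> M \<epsilon> y K p"
proof -
  obtain c where "\<forall>z\<in>\<Omega>. 1 = (\<Sum>k<K. c k * p k z)"
    using bspec[OF conjunct1[OF conjunct2[OF basis[unfolded basis_on_def]]] one_in_polys_on] by blast
  then show ?thesis
    unfolding rbf_space_def mem_Collect_eq
    by (intro exI[of _ "\<lambda>_. 0"] exI[of _ c]) (simp add: moment_conditions_def rbf_fun_def)
qed

section \<open>Weighted integrals and equidistributed nodes\<close>

context
  fixes \<Omega> :: "'a::euclidean_space set" and \<omega> :: "'a \<Rightarrow> real"
  assumes compact: "compact \<Omega>" and weight_integrable: "\<omega> riemann_integrable_on \<Omega>"
begin

lemma domain_measurable: "\<Omega> \<in> sets lebesgue"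
  using compact by (simp add: lmeasurable_compact fmeasurableD)

lemma continuous_times_weight_AE_continuous:
  assumes "continuous_on \<Omega> f"
  shows "AE z in lebesgue_on \<Omega>. continuous (at z within \<Omega>) (\<lambda>z. f z * \<omega> z)"
proof -
  have "AE z in lebesgue_on \<Omega>. z \<in> \<Omega>" by (rule AE_I2) simp
  with riemann_integrable_on_imp_AE_continuous[OF weight_integrable domain_measurable]
  show ?thesis
  proof eventually_elim
    case (elim z)
    then show ?case using assms by (intro continuous_mult) (auto simp: continuous_on_eq_continuous_within)
  qed
qed

lemma continuous_times_weight_bounded:
  assumes "continuous_on \<Omega> f"
  shows "\<exists>B. \<forall>z\<in>\<Omega>. \<bar>f z * \<omega> z\<bar> \<le> B"
proof -
  have "bounded (f ` \<Omega>)"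
    using assms compact compact_continuous_image compact_imp_bounded by blast
  then obtain A where A: "\<And>z. z \<in> \<Omega> \<Longrightarrow> \<bar>f z\<bar> \<le> A" by (auto simp: bounded_iff)
  obtain B where B: "\<And>z. z \<in> \<Omega> \<Longrightarrow> \<bar>\<omega> z\<bar> \<le> B"
    using riemann_integrable_on_imp_bounded[OF weight_integrable domain_measurable] by (auto simp: bounded_iff)
  have "\<bar>f z * \<omega> z\<bar> \<le> A * B" if "z \<in> \<Omega>" for z
    using mult_mono[OF A[OF that] B[OF that]] A[OF that] by (simp add: abs_mult)
  then show ?thesis by blast
qed

lemma continuous_times_weight_measurable:
  assumes "continuous_on \<Omega> f"
  shows "(\<lambda>z. f z * \<omega> z) \<in> borel_measurable (lebesgue_on \<Omega>)"
  by (rule borel_measurable_AE_continuous[OF domain_measurable continuous_times_weight_AE_continuous[OF assms]])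

lemma continuous_times_weight_integrable:
  assumes "continuous_on \<Omega> f"
  shows "integrable (lebesgue_on \<Omega>) (\<lambda>z. f z * \<omega> z)"
proof -
  obtain B where "\<forall>z\<in>\<Omega>. \<bar>f z * \<omega> z\<bar> \<le> B"
    using continuous_times_weight_bounded[OF assms] by blast
  then have "AE z in lebesgue_on \<Omega>. norm (f z * \<omega> z) \<le> B"
    by (intro AE_I2) simp
  moreover have "finite_measure (lebesgue_on \<Omega>)"
    using compact by (intro finite_measure_lebesgue_on lmeasurable_compact)
  ultimately show ?thesis
    using continuous_times_weight_measurable[OF assms] by (intro finite_measure.integrable_const_bound)
qed

lemma weighted_integral_eq:
  "weighted_integral \<Omega> \<omega> f = (LINT z|lebesgue_on \<Omega>. f z * \<omega> z)"
  unfolding weighted_integral_def set_lebesgue_integral_def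
  using domain_measurable by (subst integral_restrict_space) auto

lemma weighted_integral_cong:
  assumes "\<And>z. z \<in> \<Omega> \<Longrightarrow> f z = g z"
  shows "weighted_integral \<Omega> \<omega> f = weighted_integral \<Omega> \<omega> g"
  unfolding weighted_integral_eq using assms by (intro Bochner_Integration.integral_cong) auto

lemma weighted_integral_sum:
  assumes "\<And>j. j < m \<Longrightarrow> continuous_on \<Omega> (f j)"
  shows "weighted_integral \<Omega> \<omega> (\<lambda>z. \<Sum>j<m. c j * f j z) = (\<Sum>j<m. c j * weighted_integral \<Omega> \<omega> (f j))"
proof -
  have "weighted_integral \<Omega> \<omega> (\<lambda>z. \<Sum>j<m. c j * f j z)
    = (LINT z|lebesgue_on \<Omega>. (\<Sum>j<m. c j * (f j z * \<omega> z)))"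
    unfolding weighted_integral_eq by (simp add: sum_distrib_right mult.assoc)
  also have "\<dots> = (\<Sum>j<m. c j * weighted_integral \<Omega> \<omega> (f j))"
    unfolding weighted_integral_eq using assms
    by (subst Bochner_Integration.integral_sum) (auto intro!: continuous_times_weight_integrable)
  finally show ?thesis .
qed

lemma equidistributed_weighted_sums:
  assumes x: "x equidistributed_in \<Omega>" and f: "continuous_on \<Omega> f"
  shows "(\<lambda>N. \<Sum>n<N. measure lebesgue \<Omega> * \<omega> (x n) / real N * f (x n)) \<longlonglongrightarrow> weighted_integral \<Omega> \<omega> f"
proof -
  have "bounded ((\<lambda>z. f z * \<omega> z) ` \<Omega>)"
    using continuous_times_weight_bounded[OF f] by (auto simp: bounded_iff)
  then have "(\<lambda>N. measure lebesgue \<Omega> / real N * (\<Sum>n<N. f (x n) * \<omega> (x n))) \<longlonglongrightarrow> weighted_integral \<Omega> \<omega> f"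
    using x continuous_times_weight_measurable[OF f] continuous_times_weight_AE_continuous[OF f]
    unfolding equidistributed_in_def weighted_integral_def by blast
  then show ?thesis by (simp add: sum_distrib_left mult_ac)
qed

text \<open>
  If the integral vanished, \<open>s\<close> would be zero almost everywhere on \<open>\<Omega>\<close>. But a continuous \<open>s\<close> that is
  nonzero at \<open>z\<close> is nonzero on a relative neighbourhood of \<open>z\<close>, and since \<open>\<Omega>\<close> is the closure of its
  interior, this neighbourhood contains a nonempty open set.
\<close>

lemma weighted_integral_square_pos:
  assumes domain: "closure (interior \<Omega>) = \<Omega>"
    and nonneg: "\<And>z. z \<in> \<Omega> \<Longrightarrow> \<omega> z \<ge> 0" and pos: "AE z in lebesgue_on \<Omega>. \<omega> z > 0"
    and s: "continuous_on \<Omega> s" and z: "z \<in> \<Omega>" "s z \<noteq> 0"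
  shows "weighted_integral \<Omega> \<omega> (\<lambda>z. s z * s z) > 0"
proof (rule ccontr)
  assume "\<not> ?thesis"
  moreover have s2: "continuous_on \<Omega> (\<lambda>z. s z * s z)" by (intro continuous_intros s)
  have nn: "AE z in lebesgue_on \<Omega>. s z * s z * \<omega> z \<ge> 0"
    using nonneg by (intro AE_I2) auto
  moreover have "weighted_integral \<Omega> \<omega> (\<lambda>z. s z * s z) \<ge> 0"
    unfolding weighted_integral_eq using nn by (rule integral_nonneg_AE)
  ultimately have "(LINT z|lebesgue_on \<Omega>. s z * s z * \<omega> z) = 0"
    unfolding weighted_integral_eq by linarith
  then have "AE z in lebesgue_on \<Omega>. s z * s z * \<omega> z = 0"
    using integral_nonneg_eq_0_iff_AE[OF continuous_times_weight_integrable[OF s2] nn] by simp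
  with pos have "AE z in lebesgue_on \<Omega>. s z = 0"
    by eventually_elim auto
  then have "AE z in lebesgue. z \<in> \<Omega> \<longrightarrow> s z = 0"
    using domain_measurable by (subst (asm) AE_restrict_space_iff) auto
  then obtain T where T: "T \<in> null_sets lebesgue" "{z. \<not> (z \<in> \<Omega> \<longrightarrow> s z = 0)} \<subseteq> T"
    by (auto simp: eventually_ae_filter)
  have "openin (top_of_set \<Omega>) (\<Omega> \<inter> s -` (- {0}))"
    using s by (intro continuous_openin_preimage_gen) auto
  then obtain U where U: "open U" "\<Omega> \<inter> s -` (- {0}) = \<Omega> \<inter> U"
    by (auto simp: openin_open)
  have "z \<in> U" using z U(2) by auto
  then have "U \<inter> interior \<Omega> \<noteq> {}"
    using U(1) z(1) domain open_Int_closure_eq_empty[of U "interior \<Omega>"] by auto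
  moreover have "U \<inter> interior \<Omega> \<subseteq> T"
    using U(2) T(2) interior_subset[of \<Omega>] by blast
  then have "negligible (U \<inter> interior \<Omega>)"
    using T(1) negligible_subset by (metis negligible_iff_null_sets)
  ultimately show False
    using U(1) open_not_negligible[of "U \<inter> interior \<Omega>"] by auto
qed

section \<open>Positivity of the least-squares weights\<close>

text \<open>
  The argument for an arbitrary finite-dimensional space \<open>F\<close> of continuous functions on \<open>\<Omega>\<close> that
  contains the constants. Here \<open>A\<close> is the Gram matrix of the basis for the weighted inner product,
  \<open>AN N\<close> the one for the discrete inner product on the first \<open>N\<close> nodes, and \<open>u N\<close> the discrete Riesz
  representer of the weighted integral. The coefficients \<open>c\<close> of the constant function \<open>1\<close> solve the
  limit system, since the weighted integral is the inner product with \<open>1\<close>. So \<open>u N\<close> tends to \<open>1\<close>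
  uniformly on \<open>\<Omega>\<close> and is eventually positive there.
\<close>

lemma positive_least_squares_weights:
  assumes domain: "closure (interior \<Omega>) = \<Omega>"
    and nonneg: "\<And>z. z \<in> \<Omega> \<Longrightarrow> \<omega> z \<ge> 0" and pos: "AE z in lebesgue_on \<Omega>. \<omega> z > 0"
    and volume: "measure lebesgue \<Omega> > 0"
    and x: "x equidistributed_in \<Omega>" and pos_points: "\<And>n. \<omega> (x n) > 0"
    and basis: "basis_on \<Omega> M b F" and cont: "\<And>m. m < M \<Longrightarrow> continuous_on \<Omega> (b m)"
    and combs: "\<And>c. (\<lambda>z. \<Sum>m<M. c m * b m z) \<in> F" and one: "(\<lambda>_. 1) \<in> F"
    and r_def: "\<And>N n. r N n = measure lebesgue \<Omega> * \<omega> (x n) / real N"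
  shows "\<forall>\<^sub>F N in sequentially. \<exists>w \<in> exact_weights F (weighted_integral \<Omega> \<omega>) x N. (\<forall>n<N. w n > 0) \<and>
    (\<forall>v. is_least_squares_weights (exact_weights F (weighted_integral \<Omega> \<omega>) x N) (r N) N v \<longleftrightarrow> v = w)"
proof -
  define I where "I = weighted_integral \<Omega> \<omega>"
  have x_in: "x n \<in> \<Omega>" for n using x by (simp add: equidistributed_in_def)
  have span: "\<exists>c. \<forall>z\<in>\<Omega>. f z = (\<Sum>m<M. c m * b m z)" if "f \<in> F" for f
    using basis that unfolding basis_on_def by meson
  obtain c where c: "\<And>z. z \<in> \<Omega> \<Longrightarrow> (\<Sum>m<M. c m * b m z) = 1"
    using span[OF one] by metis
  define A where "A i j = I (\<lambda>z. b i z * b j z)" for i j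
  define AN where "AN N i j = (\<Sum>n<N. r N n * (b i (x n) * b j (x n)))" for N i j
  have prod: "continuous_on \<Omega> (\<lambda>z. b i z * b j z)" if "i < M" "j < M" for i j
    using cont that by (intro continuous_intros) auto
  have row: "(\<Sum>j<M. A i j * v j) = I (\<lambda>z. b i z * (\<Sum>j<M. v j * b j z))" if "i < M" for i v
  proof -
    have "I (\<lambda>z. b i z * (\<Sum>j<M. v j * b j z)) = I (\<lambda>z. \<Sum>j<M. v j * (b i z * b j z))"
      by (simp add: sum_distrib_left mult_ac)
    also have "\<dots> = (\<Sum>j<M. A i j * v j)"
      unfolding I_def using prod that by (subst weighted_integral_sum) (auto simp: A_def I_def mult.commute)
    finally show ?thesis by simp
  qed
  have "\<exists>cN. (\<forall>j<M. (\<lambda>N. cN N j) \<longlonglongrightarrow> c j) \<and>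
    (\<forall>\<^sub>F N in sequentially. \<forall>i<M. (\<Sum>j<M. AN N i j * cN N j) = I (b i))"
  proof (rule positive_definite_solution_tendsto[where A = A])
    show "(\<lambda>N. AN N i j) \<longlonglongrightarrow> A i j" if "i < M" "j < M" for i j
      unfolding AN_def A_def I_def r_def by (rule equidistributed_weighted_sums[OF x prod[OF that]])
    show "(\<lambda>_. I (b i)) \<longlonglongrightarrow> (\<Sum>j<M. A i j * c j)" if "i < M" for i
    proof -
      have "(\<Sum>j<M. A i j * c j) = I (b i)"
        unfolding row[OF that] I_def by (rule weighted_integral_cong) (simp add: c)
      then show ?thesis by simp
    qed
    show "(\<Sum>i<M. v i * (\<Sum>j<M. A i j * v j)) > 0" if "i < M" "v i \<noteq> 0" for v i
    proof -
      define s where "s z = (\<Sum>j<M. v j * b j z)" for z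
      have s: "continuous_on \<Omega> s" unfolding s_def using cont by (intro continuous_intros) auto
      have "(\<Sum>i<M. v i * (\<Sum>j<M. A i j * v j)) = (\<Sum>i<M. v i * I (\<lambda>z. b i z * s z))"
        by (simp add: row s_def)
      also have "\<dots> = I (\<lambda>z. \<Sum>i<M. v i * (b i z * s z))"
        unfolding I_def using cont s by (intro weighted_integral_sum[symmetric] continuous_intros) auto
      also have "\<dots> = I (\<lambda>z. s z * s z)"
        by (simp add: s_def sum_distrib_right mult.assoc)
      also have "\<dots> > 0"
      proof -
        have "\<forall>c. (\<forall>z\<in>\<Omega>. (\<Sum>m<M. c m * b m z) = 0) \<longrightarrow> (\<forall>m<M. c m = 0)"
          using basis by (simp add: basis_on_def)
        then have "\<not> (\<forall>z\<in>\<Omega>. s z = 0)" using that unfolding s_def by metis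
        then obtain z where "z \<in> \<Omega>" "s z \<noteq> 0" by blast
        then show ?thesis
          unfolding I_def using domain nonneg pos s by (intro weighted_integral_square_pos)
      qed
      finally show ?thesis .
    qed
  qed
  then obtain cN where lim: "\<And>j. j < M \<Longrightarrow> (\<lambda>N. cN N j) \<longlonglongrightarrow> c j"
    and sol: "\<forall>\<^sub>F N in sequentially. \<forall>i<M. (\<Sum>j<M. AN N i j * cN N j) = I (b i)"
    by blast
  define u where "u N z = (\<Sum>j<M. cN N j * b j z)" for N z
  have "\<forall>j. \<exists>B. j < M \<longrightarrow> (\<forall>z\<in>\<Omega>. \<bar>b j z\<bar> \<le> B)"
  proof
    fix j
    show "\<exists>B. j < M \<longrightarrow> (\<forall>z\<in>\<Omega>. \<bar>b j z\<bar> \<le> B)"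
    proof (cases "j < M")
      case True
      then have "bounded (b j ` \<Omega>)"
        using cont compact compact_continuous_image compact_imp_bounded by blast
      then show ?thesis by (auto simp: bounded_iff)
    qed simp
  qed
  then obtain B where B: "\<And>j z. j < M \<Longrightarrow> z \<in> \<Omega> \<Longrightarrow> \<bar>b j z\<bar> \<le> B j" by metis
  have "(\<lambda>N. \<Sum>j<M. \<bar>cN N j - c j\<bar> * B j) \<longlonglongrightarrow> (\<Sum>j<M. \<bar>c j - c j\<bar> * B j)"
    by (intro tendsto_intros lim) auto
  then have "\<forall>\<^sub>F N in sequentially. (\<Sum>j<M. \<bar>cN N j - c j\<bar> * B j) < 1"
    by (rule order_tendstoD) simp
  then have u_pos: "\<forall>\<^sub>F N in sequentially. \<forall>z\<in>\<Omega>. u N z > 0"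
  proof eventually_elim
    case (elim N)
    show ?case
    proof
      fix z assume z: "z \<in> \<Omega>"
      have "1 - u N z = (\<Sum>j<M. (c j - cN N j) * b j z)"
        using c[OF z] by (simp add: u_def left_diff_distrib sum_subtractf)
      also have "\<dots> \<le> (\<Sum>j<M. \<bar>cN N j - c j\<bar> * B j)"
      proof (rule sum_mono)
        fix j assume "j \<in> {..<M}"
        then have "\<bar>(c j - cN N j) * b j z\<bar> \<le> \<bar>cN N j - c j\<bar> * B j"
          unfolding abs_mult abs_minus_commute[of "c j"] using B z by (intro mult_left_mono) auto
        then show "(c j - cN N j) * b j z \<le> \<bar>cN N j - c j\<bar> * B j" by linarith
      qed
      finally show "u N z > 0" using elim by linarith
    qed
  qed
  show ?thesis
    unfolding I_def[symmetric] using sol u_pos eventually_gt_at_top[of 0]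
  proof eventually_elim
    case (elim N)
    have r_pos: "r N n > 0" for n
      using volume pos_points elim(3) by (simp add: r_def)
    define w where "w = (\<lambda>n\<in>{..<N}. r N n * u N (x n))"
    have "(\<Sum>n<N. w n * f (x n)) = I f" if "f \<in> F" for f
    proof -
      obtain a where a: "\<And>z. z \<in> \<Omega> \<Longrightarrow> f z = (\<Sum>m<M. a m * b m z)"
        using span[OF \<open>f \<in> F\<close>] by metis
      have "(\<Sum>n<N. w n * f (x n)) = (\<Sum>n<N. \<Sum>i<M. a i * (r N n * (b i (x n) * u N (x n))))"
        by (intro sum.cong) (auto simp: w_def a x_in sum_distrib_left mult_ac)
      also have "\<dots> = (\<Sum>i<M. a i * (\<Sum>n<N. r N n * (b i (x n) * u N (x n))))"
        by (subst sum.swap) (simp add: sum_distrib_left)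
      also have "\<dots> = (\<Sum>i<M. a i * (\<Sum>j<M. AN N i j * cN N j))"
        unfolding AN_def u_def sum_distrib_left sum_distrib_right
        by (rule sum.cong[OF refl], subst sum.swap) (simp add: mult_ac)
      also have "\<dots> = (\<Sum>i<M. a i * I (b i))" using elim(1) by simp
      also have "\<dots> = I f"
        unfolding I_def using cont by (subst weighted_integral_sum[symmetric]) (auto intro: weighted_integral_cong simp: a)
      finally show ?thesis .
    qed
    then have w: "w \<in> exact_weights F I x N" by (auto simp: exact_weights_def w_def)
    have "u N \<in> F" unfolding u_def by (rule combs)
    then have "is_least_squares_weights (exact_weights F I x N) (r N) N v \<longleftrightarrow> v = w" for v
      using r_pos w by (intro least_squares_weights_iff[where u = "u N"] w_def) auto
    moreover have "w n > 0" if "n < N" for n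
      using that r_pos elim(2) x_in by (simp add: w_def)
    ultimately show ?case using w by blast
  qed
qed

end

theorem corollary5p2:
  fixes \<Omega> :: "(real ^ 'D) set"
    and \<omega> :: "real ^ 'D \<Rightarrow> real"
    and \<phi> :: "real \<Rightarrow> real"
    and d M K :: nat
    and p :: "nat \<Rightarrow> real ^ 'D \<Rightarrow> real"
    and y :: "nat \<Rightarrow> real ^ 'D"
    and \<epsilon> :: "nat \<Rightarrow> real"
    and x :: "nat \<Rightarrow> real ^ 'D"
    and S :: "(real ^ 'D \<Rightarrow> real) set"
    and I :: "(real ^ 'D \<Rightarrow> real) \<Rightarrow> real"
    and r :: "nat \<Rightarrow> nat \<Rightarrow> real"
    and W :: "nat \<Rightarrow> (nat \<Rightarrow> real) set"
  assumes compact: "compact \<Omega>"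
    and volume: "measure lebesgue \<Omega> > 0"
    and domain: "closure (interior \<Omega>) = \<Omega>"
    and weight_nonneg: "\<And>z. z \<in> \<Omega> \<Longrightarrow> \<omega> z \<ge> 0"
    and weight_integrable: "\<omega> riemann_integrable_on \<Omega>"
    and weight_pos: "AE z in lebesgue_on \<Omega>. \<omega> z > 0"
    and poly_basis: "basis_on \<Omega> K p (polys_on \<Omega> d)"
    and kernel_continuous: "continuous_on {0..} \<phi>"
    and kernel_cpd: "conditionally_pos_def_on (UNIV :: (real ^ 'D) set) d \<phi>"
    and centers: "\<And>m. m < M \<Longrightarrow> y m \<in> \<Omega>"
    and centers_distinct: "inj_on y {..<M}"
    and shape: "\<And>m. m < M \<Longrightarrow> \<epsilon> m \<ge> 0"
    and solvable: "uniquely_solvable \<phi> M \<epsilon> y K p"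
    and S_def: "S = rbf_space \<Omega> \<phi> M \<epsilon> y K p"
    and I_def: "I = weighted_integral \<Omega> \<omega>"
    and equidistributed: "x equidistributed_in \<Omega>"
    and weight_pos_points: "\<And>n. \<omega> (x n) > 0"
    and r_def: "\<And>N n. r N n = measure lebesgue \<Omega> * \<omega> (x n) / real N"
    and W_def: "\<And>N. W N = exact_weights S I x N"
  shows "\<exists>N0. \<forall>N\<ge>N0.
    (\<exists>!w. is_least_squares_weights (W N) (r N) N w) \<and>
    (\<forall>w. is_least_squares_weights (W N) (r N) N w \<longrightarrow>
      (\<forall>n<N. w n > 0) \<and>
      (\<forall>f\<in>S. (\<Sum>n<N. w n * f (x n)) = I f))"
proof -
  obtain b where basis: "basis_on \<Omega> M b S"
    unfolding S_def using rbf_space_cardinal_basis[of \<phi> M \<epsilon> y K p \<Omega>] solvable centers by metis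
  then have b: "b m \<in> S" if "m < M" for m
    using that by (simp add: basis_on_def)
  have p_cont: "continuous_on \<Omega> (p k)" if "k < K" for k
    by (rule continuous_on_polys_on[where d = d]) (use poly_basis that in \<open>simp add: basis_on_def\<close>)
  have cont: "continuous_on \<Omega> (b m)" if "m < M" for m
    by (rule continuous_on_rbf_space[OF b[OF that, unfolded S_def] kernel_continuous shape p_cont])
  have combs: "(\<lambda>z. \<Sum>m<M. c m * b m z) \<in> S" for c
    using b unfolding S_def by (rule rbf_space_sum)
  have one: "(\<lambda>_. 1) \<in> S"
    unfolding S_def by (rule one_in_rbf_space[OF poly_basis])
  have "\<forall>\<^sub>F N in sequentially. \<exists>w\<in>W N. (\<forall>n<N. w n > 0) \<and>
    (\<forall>v. is_least_squares_weights (W N) (r N) N v \<longleftrightarrow> v = w)"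
    unfolding W_def I_def
    by (rule positive_least_squares_weights[where b = b and M = M]; fact)
  then obtain N0 where N0: "\<And>N. N \<ge> N0 \<Longrightarrow> \<exists>w\<in>W N. (\<forall>n<N. w n > 0) \<and>
    (\<forall>v. is_least_squares_weights (W N) (r N) N v \<longleftrightarrow> v = w)"
    unfolding eventually_sequentially by blast
  show ?thesis
  proof (intro exI[of _ N0] allI impI)
    fix N assume "N0 \<le> N"
    then obtain w where "w \<in> W N" "\<forall>n<N. w n > 0"
      and ls: "\<And>v. is_least_squares_weights (W N) (r N) N v \<longleftrightarrow> v = w"
      using N0 by blast
    then show "(\<exists>!w. is_least_squares_weights (W N) (r N) N w) \<and>
      (\<forall>w. is_least_squares_weights (W N) (r N) N w \<longrightarrow>
        (\<forall>n<N. w n > 0) \<and> (\<forall>f\<in>S. (\<Sum>n<N. w n * f (x n)) = I f))"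
      unfolding ls by (auto simp: W_def exact_weights_def)
  qed
qed

end
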